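(* Let $q$ be a prime power, $k=\mathbb{F}_q$, $n\ge 1$ an integer, and $\lambda$ a nontrivial additive character of $k$. Let $U\in \mathrm{M}_n(k)$ be a nonzero matrix and let $u$ be the rank of $U$. Then $$G_{\mathrm{SL}_n(k)}(U,\lambda)=\begin{cases} q^{\binom{n}{2}}K_n(\lambda,\det U) & \text{if } u=n,\\[4pt] (-1)^u q^{\binom{n}{2}}\displaystyle\prod_{i=2}^{n-u}(q^i-1) & \text{if } u<n.\end{cases}$$
   Context: $\mathrm{M}_n(k)$ is the set of $n\times n$ matrices over $k$. For $U=(u_{ij}),V=(v_{ij})\in \mathrm{M}_n(k)$, put $U\cdot V=\sum_{1\le i,j\le n}u_{ij}v_{ij}\in k$ (entrywise product summed, not matrix multiplication). An additive character is a homomorphism $(k,+)\to\mathbb{C}^*$. Define $$G_{\mathrm{SL}_n(k)}(U,\lambda)=\sum_{X\in \mathrm{SL}_n(k)}\lambda(U\cdot X),$$ and, for $y\in k^*$, the Kloosterman sum $$K_n(\lambda,y)=\sum_{\substack{x_1,\dots,x_n\in k\\ x_1x_2\cdots x_n=y}}\lambda(x_1+x_2+\cdots+x_n).$$ Empty products equal $1$. *)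

theory Defs
  imports Complex_Main "HOL-Library.FuncSet" "HOL-Library.Cardinality"
    "Jordan_Normal_Form.Determinant" "Jordan_Normal_Form.DL_Rank"
begin

text \<open>Homomorphisms from the additive group of \<open>'a\<close> to the multiplicative group of nonzero
  complex numbers.\<close>

definition additive_character :: "('a::field \<Rightarrow> complex) \<Rightarrow> bool" where
  "additive_character \<psi> \<longleftrightarrow> (\<forall>x. \<psi> x \<noteq> 0) \<and> (\<forall>x y. \<psi> (x + y) = \<psi> x * \<psi> y)"

definition nontrivial_character :: "('a::field \<Rightarrow> complex) \<Rightarrow> bool" where
  "nontrivial_character \<psi> \<longleftrightarrow> (\<exists>x. \<psi> x \<noteq> 1)"

definition SL_mat :: "nat \<Rightarrow> 'a::field mat set" where
  "SL_mat n = {X \<in> carrier_mat n n. det X = 1}"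

definition mat_dot :: "nat \<Rightarrow> 'a::field mat \<Rightarrow> 'a mat \<Rightarrow> 'a" where
  "mat_dot n U V = (\<Sum>i<n. \<Sum>j<n. U $$ (i, j) * V $$ (i, j))"

definition gauss_sum_SL :: "nat \<Rightarrow> 'a::{field, finite} mat \<Rightarrow> ('a \<Rightarrow> complex) \<Rightarrow> complex" where
  "gauss_sum_SL n U \<psi> = (\<Sum>X \<in> SL_mat n. \<psi> (mat_dot n U X))"

text \<open>The tuples \<open>(x\<^sub>1, \<dots>, x\<^sub>n)\<close> are the extensional functions on \<open>{1..n}\<close>.\<close>

definition kloosterman_sum :: "nat \<Rightarrow> ('a::{field, finite} \<Rightarrow> complex) \<Rightarrow> 'a \<Rightarrow> complex" where
  "kloosterman_sum n \<psi> y =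
     (\<Sum>x \<in> {x \<in> {1..n} \<rightarrow>\<^sub>E UNIV. (\<Prod>i = 1..n. x i) = y}. \<psi> (\<Sum>i = 1..n. x i))"

text \<open>\<^const>\<open>sum\<close> is zero over an infinite index set, so we record that both index sets are finite.\<close>

lemma finite_SL_mat: "finite (SL_mat n :: 'a::{field, finite} mat set)"
proof -
  let ?F = "({..<n} \<times> {..<n}) \<rightarrow>\<^sub>E (UNIV :: 'a set)"
  have "SL_mat n \<subseteq> (\<lambda>f. mat n n f) ` ?F"
  proof
    fix X :: "'a mat" assume "X \<in> SL_mat n"
    then have X: "X \<in> carrier_mat n n" by (simp add: SL_mat_def)
    have "X = mat n n (restrict (($$) X) ({..<n} \<times> {..<n}))"
      using X by (intro eq_matI) simp_all
    moreover have "restrict (($$) X) ({..<n} \<times> {..<n}) \<in> ?F"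
      by (rule restrict_PiE_iff[THEN iffD2]) simp
    ultimately show "X \<in> (\<lambda>f. mat n n f) ` ?F" by (rule image_eqI)
  qed
  moreover have "finite ?F" by (rule finite_PiE) simp_all
  ultimately show ?thesis by (rule finite_subset[OF _ finite_imageI])
qed

lemma finite_kloosterman_index:
  "finite {x \<in> {1..n :: nat} \<rightarrow>\<^sub>E (UNIV :: 'a::{field, finite} set). (\<Prod>i = 1..n. x i) = y}"
proof (rule finite_subset)
  show "finite ({1..n :: nat} \<rightarrow>\<^sub>E (UNIV :: 'a set))" by (rule finite_PiE) simp_all
qed simp

end

theory Submission
  imports Defs
begin

text \<open>Write \<open>U = P D Q\<close> with \<open>P\<close>, \<open>Q\<close> invertible and \<open>D = diag(1, \<dots>, 1, 0, \<dots>, 0)\<close> of rank \<open>u\<close>.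
  Substituting \<open>P\<^sup>T X Q\<^sup>T\<close> for \<open>X\<close> turns the sum over \<open>det X = 1\<close> into the sum for \<open>D\<close> over
  \<open>det X = det P det Q\<close>. If \<open>u \<ge> 1\<close>, averaging over the shears \<open>X \<mapsto> X (1 + \<Sum>\<^sub>j c\<^sub>j E\<^sub>j\<^sub>0)\<close> kills every
  \<open>X\<close> whose first row is not of the form \<open>(x, 0, \<dots>, 0)\<close>. This peels off one row and column and leaves
  a factor \<open>q\<^sup>n\<^sup>-\<^sup>1\<close> and a sum of \<open>\<psi> x\<close> over \<open>x \<noteq> 0\<close>. For \<open>u = n\<close> this is the recursion of the Kloosterman
  sums; for \<open>u < n\<close> the smaller sum does not depend on the determinant, so each step contributes \<open>-q\<^sup>n\<^sup>-\<^sup>1\<close>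
  until only a count of matrices of given determinant remains. That count also follows from the rank
  one sums: those of the matrices supported on the first row, together with the zero matrix, add up to
  zero by orthogonality of characters.\<close>

section \<open>The bilinear form\<close>

text \<open>The form is rectangular because the blocks left after splitting off a row and a column
  are not square; for square matrices it is \<open>mat_dot\<close>.\<close>

definition mat_inner :: "nat \<Rightarrow> nat \<Rightarrow> 'a::comm_ring_1 mat \<Rightarrow> 'a mat \<Rightarrow> 'a" where
  "mat_inner nr nc A B = (\<Sum>i<nr. \<Sum>j<nc. A $$ (i, j) * B $$ (i, j))"

text \<open>Left multiplication by \<open>P\<close> is adjoint to left multiplication by its
  transpose. This moves the outer factors of a normal form from the fixed matrix onto the summation
  variable.\<close>

lemma mat_inner_mult_left:
  assumes P: "P \<in> carrier_mat nr k" and A: "A \<in> carrier_mat k nc" and X: "X \<in> carrier_mat nr nc"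
  shows "mat_inner nr nc (P * A) X = mat_inner k nc A (transpose_mat P * X)"
proof -
  have "mat_inner nr nc (P * A) X = (\<Sum>i<nr. \<Sum>j<nc. \<Sum>l<k. P $$ (i, l) * A $$ (l, j) * X $$ (i, j))"
    using P A unfolding mat_inner_def
    by (intro sum.cong refl) (simp add: scalar_prod_def sum_distrib_right atLeast0LessThan)
  also have "\<dots> = (\<Sum>i<nr. \<Sum>l<k. \<Sum>j<nc. P $$ (i, l) * A $$ (l, j) * X $$ (i, j))"
    by (intro sum.cong refl sum.swap)
  also have "\<dots> = (\<Sum>l<k. \<Sum>i<nr. \<Sum>j<nc. P $$ (i, l) * A $$ (l, j) * X $$ (i, j))"
    by (rule sum.swap)
  also have "\<dots> = (\<Sum>l<k. \<Sum>j<nc. \<Sum>i<nr. P $$ (i, l) * A $$ (l, j) * X $$ (i, j))"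
    by (intro sum.cong refl sum.swap)
  also have "\<dots> = mat_inner k nc A (transpose_mat P * X)"
    using P X unfolding mat_inner_def
    by (intro sum.cong refl) (simp add: scalar_prod_def sum_distrib_left atLeast0LessThan ac_simps)
  finally show ?thesis .
qed

lemma mat_inner_mult_right:
  assumes A: "A \<in> carrier_mat nr k" and Q: "Q \<in> carrier_mat k nc" and X: "X \<in> carrier_mat nr nc"
  shows "mat_inner nr nc (A * Q) X = mat_inner nr k A (X * transpose_mat Q)"
proof -
  have "mat_inner nr nc (A * Q) X = (\<Sum>i<nr. \<Sum>j<nc. \<Sum>l<k. A $$ (i, l) * Q $$ (l, j) * X $$ (i, j))"
    using Q A unfolding mat_inner_def
    by (intro sum.cong refl) (simp add: scalar_prod_def sum_distrib_right atLeast0LessThan)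
  also have "\<dots> = (\<Sum>i<nr. \<Sum>l<k. \<Sum>j<nc. A $$ (i, l) * Q $$ (l, j) * X $$ (i, j))"
    by (intro sum.cong refl sum.swap)
  also have "\<dots> = mat_inner nr k A (X * transpose_mat Q)"
    using Q X unfolding mat_inner_def
    by (intro sum.cong refl) (simp add: scalar_prod_def sum_distrib_left atLeast0LessThan ac_simps)
  finally show ?thesis .
qed

lemma sum_lessThan_add:
  fixes f :: "nat \<Rightarrow> 'b::comm_monoid_add"
  shows "(\<Sum>i<a + b. f i) = (\<Sum>i<a. f i) + (\<Sum>i<b. f (a + i))"
  by (induction b) (simp_all add: add.assoc)

lemma mat_inner_four_block:
  assumes "A \<in> carrier_mat a c" "B \<in> carrier_mat a d" "C \<in> carrier_mat b c" "D \<in> carrier_mat b d"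
    and "A' \<in> carrier_mat a c" "B' \<in> carrier_mat a d" "C' \<in> carrier_mat b c" "D' \<in> carrier_mat b d"
  shows "mat_inner (a + b) (c + d) (four_block_mat A B C D) (four_block_mat A' B' C' D') =
    mat_inner a c A A' + mat_inner a d B B' + mat_inner b c C C' + mat_inner b d D D'"
  using assms unfolding mat_inner_def
  by (simp add: sum_lessThan_add sum.distrib)

lemma mat_inner_add_right:
  assumes "A \<in> carrier_mat nr nc" "B \<in> carrier_mat nr nc"
  shows "mat_inner nr nc X (A + B) = mat_inner nr nc X A + mat_inner nr nc X B"
  using assms by (simp add: mat_inner_def distrib_left sum.distrib)

lemma mat_inner_0_left [simp]: "mat_inner nr nc (0\<^sub>m nr nc) X = 0"
  by (simp add: mat_inner_def)

lemma mat_inner_commute: "mat_inner nr nc A B = mat_inner nr nc B A"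
  by (simp add: mat_inner_def mult.commute)

text \<open>A matrix supported at one nonzero entry of \<open>X\<close> can be scaled to reach any
  value \<open>t\<close>, in particular one where a character is not 1.\<close>

lemma mat_inner_nondegenerate:
  fixes X :: "'a::field mat"
  assumes X: "X \<in> carrier_mat nr nc" and "X \<noteq> 0\<^sub>m nr nc"
  obtains V where "V \<in> carrier_mat nr nc" "mat_inner nr nc X V = t"
proof -
  obtain i j where ij: "i < nr" "j < nc" "X $$ (i, j) \<noteq> 0"
    using assms by (metis carrier_matD(1) carrier_matD(2) eq_matI index_zero_mat)
  define V where "V = mat nr nc (\<lambda>p. if p = (i, j) then t / X $$ (i, j) else 0)"
  have "mat_inner nr nc X V = (\<Sum>k<nr. \<Sum>l<nc. if k = i then (if l = j then t else 0) else 0)"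
    unfolding mat_inner_def V_def using ij by (intro sum.cong refl) auto
  also have "\<dots> = (\<Sum>k<nr. if k = i then (\<Sum>l<nc. if l = j then t else 0) else 0)"
    by (intro sum.cong refl) auto
  also have "\<dots> = t" using ij by simp
  finally show thesis using that[of V] by (simp add: V_def)
qed

section \<open>Matrices of given determinant\<close>

lemma card_carrier_mat:
  "card (carrier_mat nr nc :: 'a::finite mat set) = CARD('a) ^ (nr * nc)"
    and finite_carrier_mat: "finite (carrier_mat nr nc :: 'a::finite mat set)"
proof -
  let ?F = "({..<nr} \<times> {..<nc}) \<rightarrow>\<^sub>E (UNIV :: 'a set)"
  have bij: "bij_betw (mat nr nc) ?F (carrier_mat nr nc)"
  proof (rule bij_betw_byWitness[where f' = "\<lambda>X. restrict (($$) X) ({..<nr} \<times> {..<nc})"])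
    show "\<forall>f\<in>?F. restrict (($$) (mat nr nc f)) ({..<nr} \<times> {..<nc}) = f"
      by (auto intro!: ext simp: restrict_def PiE_def extensional_def)
    show "\<forall>X\<in>carrier_mat nr nc. mat nr nc (restrict (($$) X) ({..<nr} \<times> {..<nc})) = X"
      by (auto intro!: eq_matI)
    show "(\<lambda>X. restrict (($$) X) ({..<nr} \<times> {..<nc})) ` carrier_mat nr nc \<subseteq> ?F"
      by (intro image_subsetI restrict_PiE_iff[THEN iffD2]) simp
  qed auto
  have fin: "finite ?F" by (rule finite_PiE) simp_all
  show "finite (carrier_mat nr nc :: 'a mat set)"
    using bij_betw_finite[OF bij] fin by blast
  have "card ?F = CARD('a) ^ (nr * nc)" by (subst card_PiE) simp_all
  then show "card (carrier_mat nr nc :: 'a mat set) = CARD('a) ^ (nr * nc)"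
    using bij_betw_same_card[OF bij] by simp
qed

definition det_mats :: "nat \<Rightarrow> 'a::comm_ring_1 \<Rightarrow> 'a mat set" where
  "det_mats n d = {X \<in> carrier_mat n n. det X = d}"

lemma finite_det_mats: "finite (det_mats n d :: 'a::{comm_ring_1,finite} mat set)"
  unfolding det_mats_def by (rule finite_subset[OF _ finite_carrier_mat]) auto

lemma inverse_mat_ex:
  assumes "P \<in> carrier_mat n n" "det P \<noteq> (0::'a::field)"
  obtains P' where "P' \<in> carrier_mat n n" "P * P' = 1\<^sub>m n" "P' * P = 1\<^sub>m n"
  using det_non_zero_imp_unit[OF assms] assms(1) unfolding Units_def ring_mat_def by auto

text \<open>Multiplication by the inverse \<open>P'\<close> undoes the map, and
  \<open>det P' * det P = 1\<close> brings the determinant back to \<open>d\<close>.\<close>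

lemma bij_betw_det_mats_mult_left:
  assumes P: "P \<in> carrier_mat n n" and dP: "det P \<noteq> (0::'a::field)"
  shows "bij_betw ((*) P) (det_mats n d) (det_mats n (det P * d))"
proof -
  obtain P' where P': "P' \<in> carrier_mat n n" and inv: "P * P' = 1\<^sub>m n" "P' * P = 1\<^sub>m n"
    using inverse_mat_ex[OF P dP] .
  have det_inv: "det P' * det P = 1"
    using det_mult[OF P' P] inv by simp
  show ?thesis
    using P P' inv det_inv
    by (intro bij_betw_byWitness[where f' = "(*) P'"])
      (auto simp: det_mats_def assoc_mult_mat[symmetric, of _ n n _ n _ n] det_mult[of _ n])
qed

lemma bij_betw_det_mats_mult_right:
  assumes P: "P \<in> carrier_mat n n" and dP: "det P \<noteq> (0::'a::field)"
  shows "bij_betw (\<lambda>X. X * P) (det_mats n d) (det_mats n (d * det P))"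
proof -
  obtain P' where P': "P' \<in> carrier_mat n n" and inv: "P * P' = 1\<^sub>m n" "P' * P = 1\<^sub>m n"
    using inverse_mat_ex[OF P dP] .
  have det_inv: "det P * det P' = 1"
    using det_mult[OF P P'] inv by simp
  show ?thesis
    using P P' inv det_inv
    by (intro bij_betw_byWitness[where f' = "\<lambda>X. X * P'"])
      (auto simp: det_mats_def assoc_mult_mat[of _ n n _ n _ n] det_mult[of _ n])
qed

section \<open>Rank normal form\<close>

definition diag_one :: "nat \<Rightarrow> nat \<Rightarrow> 'a::zero_neq_one mat" where
  "diag_one n r = mat n n (\<lambda>(i, j). if i = j \<and> i < r then 1 else 0)"

lemma diag_one_carrier [simp]: "diag_one n r \<in> carrier_mat n n"
  by (simp add: diag_one_def)

lemma diag_one_0 [simp]: "diag_one n 0 = 0\<^sub>m n n"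
  by (auto simp: diag_one_def intro!: eq_matI)

lemma diag_one_self [simp]: "diag_one n n = 1\<^sub>m n"
  by (auto simp: diag_one_def intro!: eq_matI)

lemma diag_one_Suc:
  "diag_one (1 + m) (Suc r) = four_block_mat (1\<^sub>m 1) (0\<^sub>m 1 m) (0\<^sub>m m 1) (diag_one m r)"
  by (auto simp: diag_one_def intro!: eq_matI)

text \<open>Rank is not mentioned: elimination yields some \<open>r\<close>, identified with the
  rank afterwards. The bound \<open>r \<le> n\<close> is kept apart because every
  \<open>r \<ge> n\<close> makes \<open>diag_one n r\<close> the identity.\<close>

definition rank_factorization :: "nat \<Rightarrow> nat \<Rightarrow> 'a::field mat \<Rightarrow> bool" where
  "rank_factorization n r U \<longleftrightarrow> (\<exists>P Q. P \<in> carrier_mat n n \<and> Q \<in> carrier_mat n n \<and>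
     det P \<noteq> 0 \<and> det Q \<noteq> 0 \<and> U = P * diag_one n r * Q)"

lemma rank_factorization_mult:
  assumes "rank_factorization n r U" "A \<in> carrier_mat n n" "B \<in> carrier_mat n n"
    "det A \<noteq> 0" "det B \<noteq> 0"
  shows "rank_factorization n r (A * U * B)"
proof -
  obtain P Q where PQ: "P \<in> carrier_mat n n" "Q \<in> carrier_mat n n" "det P \<noteq> 0" "det Q \<noteq> 0"
    and U: "U = P * diag_one n r * Q"
    using assms(1) unfolding rank_factorization_def by blast
  have "A * (P * D * Q) * B = (A * P) * D * (Q * B)" if "D \<in> carrier_mat n n" for D
    using PQ assms(2,3) that by (simp add: assoc_mult_mat[of _ n n _ n _ n])
  then have "A * U * B = (A * P) * diag_one n r * (Q * B)"
    unfolding U by simp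
  then show ?thesis
    unfolding rank_factorization_def using PQ assms(2-5)
    by (intro exI[of _ "A * P"] exI[of _ "Q * B"]) (simp add: det_mult[of _ n])
qed

text \<open>A swap is an involution, so its determinant squares to 1.\<close>

lemma det_swaprows_mat_nonzero:
  assumes "i < n" "j < n"
  shows "det (swaprows_mat n i j :: 'a::field mat) \<noteq> 0"
proof -
  have "det (swaprows_mat n i j :: 'a mat) * det (swaprows_mat n i j) = 1"
    using swaprows_mat_inv[OF assms, where 'a = 'a] det_mult[of "swaprows_mat n i j :: 'a mat" n "swaprows_mat n i j"] by simp
  then show ?thesis by auto
qed

text \<open>A nonzero entry is moved to the corner and its row and column are cleared.\<close>

lemma rank_factorization_ex:
  fixes U :: "'a::field mat"
  assumes "U \<in> carrier_mat n n"
  shows "\<exists>r\<le>n. rank_factorization n r U"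
  using assms
proof (induction n arbitrary: U)
  case 0
  then have "U = 1\<^sub>m 0 * diag_one 0 0 * 1\<^sub>m 0" by (auto intro!: eq_matI)
  then show ?case unfolding rank_factorization_def
    by (intro exI[of _ 0] conjI exI[of _ "1\<^sub>m 0"]) auto
next
  case (Suc m)
  show ?case
  proof (cases "U = 0\<^sub>m (Suc m) (Suc m)")
    case True
    then have "U = 1\<^sub>m (Suc m) * diag_one (Suc m) 0 * 1\<^sub>m (Suc m)" by simp
    then show ?thesis unfolding rank_factorization_def
      by (intro exI[of _ 0] conjI exI[of _ "1\<^sub>m (Suc m)"]) auto
  next
    case False
    then obtain i j where ij: "i < Suc m" "j < Suc m" "U $$ (i, j) \<noteq> 0"
      using Suc.prems by (metis carrier_matD(1) carrier_matD(2) eq_matI index_zero_mat)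
    let ?n = "Suc m"
    define S where "S = (swaprows_mat ?n 0 i :: 'a mat)"
    define T where "T = (swaprows_mat ?n 0 j :: 'a mat)"
    have ST: "S \<in> carrier_mat ?n ?n" "T \<in> carrier_mat ?n ?n" "S * S = 1\<^sub>m ?n" "T * T = 1\<^sub>m ?n"
      and dST: "det S \<noteq> 0" "det T \<noteq> 0"
      unfolding S_def T_def using ij
      by (simp_all add: swaprows_mat_inv det_swaprows_mat_nonzero del: One_nat_def)
    define V where "V = S * U * T"
    have V: "V \<in> carrier_mat ?n ?n" unfolding V_def using ST Suc.prems by simp
    define a where "a = V $$ (0, 0)"
    have "V $$ (0, 0) = U $$ (i, j)"
    proof -
      \<comment> \<open>Right multiplication by \<open>T\<close> puts column \<open>j\<close> first,
        since the first column of \<open>T\<close> is the unit vector at \<open>j\<close>.\<close>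
      have "col (swaprows_mat ?n 0 j) 0 = (unit_vec ?n j :: 'a vec)"
        using ij by (auto intro!: eq_vecI simp: unit_vec_def)
      then show ?thesis
        unfolding V_def S_def T_def using ij Suc.prems
        by (simp add: swaprows_mat[of U, symmetric])
    qed
    then have a: "a \<noteq> 0" using ij unfolding a_def by simp
    have UV: "U = S * V * T"
    proof -
      have "S * V * T = (S * S) * U * (T * T)"
        unfolding V_def using ST(1,2) Suc.prems by (simp add: assoc_mult_mat[of _ ?n ?n _ ?n _ ?n])
      then show ?thesis using ST Suc.prems by simp
    qed
    define b where "b = mat 1 m (\<lambda>(_, j). V $$ (0, Suc j) / a)"
    define c where "c = mat m 1 (\<lambda>(i, _). V $$ (Suc i, 0))"
    \<comment> \<open>\<open>E\<close> is the Schur complement of the corner entry \<open>a\<close>,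
      the block that remains after clearing the first row and column.\<close>
    define E where "E = mat m m (\<lambda>(i, j). V $$ (Suc i, Suc j) - V $$ (Suc i, 0) * V $$ (0, Suc j) / a)"
    obtain r P Q where r: "r \<le> m" and PQ: "P \<in> carrier_mat m m" "Q \<in> carrier_mat m m"
      "det P \<noteq> 0" "det Q \<noteq> 0" and E: "E = P * diag_one m r * Q"
      using Suc.IH[of E] unfolding rank_factorization_def E_def by auto
    \<comment> \<open>Only the row \<open>b\<close> has been divided by \<open>a\<close>, so
      \<open>c * b\<close> is exactly what \<open>E\<close> subtracts, and the corner
      \<open>a\<close> of \<open>L\<close> restores the first row of \<open>V\<close>.\<close>
    define L where "L = four_block_mat (mat 1 1 (\<lambda>_. a)) (0\<^sub>m 1 m) c P"
    define R where "R = four_block_mat (1\<^sub>m 1) b (0\<^sub>m m 1) Q"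
    have bc: "b \<in> carrier_mat 1 m" "c \<in> carrier_mat m 1" by (simp_all add: b_def c_def)
    have LR: "L \<in> carrier_mat (1 + m) (1 + m)" "R \<in> carrier_mat (1 + m) (1 + m)"
      unfolding L_def R_def using PQ bc by (simp_all del: One_nat_def)
    have dL: "det L \<noteq> 0" unfolding L_def
      by (subst det_four_block_mat_upper_right_zero[of _ 1 _ m]) (use PQ bc a in \<open>simp_all add: det_single\<close>)
    have dR: "det R \<noteq> 0" unfolding R_def
      by (subst det_four_block_mat_lower_left_zero[of _ 1 _ m]) (use PQ bc a in \<open>simp_all add: det_single\<close>)
    have "four_block_mat (mat 1 1 (\<lambda>_. a)) (0\<^sub>m 1 m) c P *
        four_block_mat (1\<^sub>m 1) (0\<^sub>m 1 m) (0\<^sub>m m 1) D *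
        four_block_mat (1\<^sub>m 1) b (0\<^sub>m m 1) Q =
        four_block_mat (mat 1 1 (\<lambda>_. a)) (mat 1 1 (\<lambda>_. a) * b) c (c * b + P * D * Q)"
      if "D \<in> carrier_mat m m" for D
      using PQ bc that
      by (simp add: mult_four_block_mat[of _ 1 1 _ m _ m _ _ 1 _ m] right_add_zero_mat[of _ 1 m] mult_carrier_mat[of _ 1 1 _ m] del: One_nat_def)
    then have "L * diag_one (1 + m) (Suc r) * R =
        four_block_mat (mat 1 1 (\<lambda>_. a)) (mat 1 1 (\<lambda>_. a) * b) c (c * b + E)"
      unfolding diag_one_Suc L_def R_def E by (simp del: One_nat_def)
    also have "\<dots> = V"
      using V a bc PQ(1,2) by (intro eq_matI) (auto simp: a_def b_def c_def E[symmetric] E_def scalar_prod_def split: nat.splits)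
    finally have "rank_factorization ?n (Suc r) V"
      unfolding rank_factorization_def using LR dL dR by auto
    then have "rank_factorization ?n (Suc r) U"
      unfolding UV using rank_factorization_mult ST dST by blast
    then show ?thesis using r by auto
  qed
qed


section \<open>Rank of the normal form\<close>

text \<open>An invertible \<open>Q\<close> permutes the vectors to which \<open>A\<close> is
  applied, so \<open>A * Q\<close> and \<open>A\<close> have the same column space.\<close>

lemma rank_mult_invertible_right:
  fixes A Q :: "'a::field mat"
  assumes A: "A \<in> carrier_mat n k" and Q: "Q \<in> carrier_mat k k" and dQ: "det Q \<noteq> 0"
  shows "vec_space.rank n (A * Q) = vec_space.rank n A"
proof -
  interpret vec_space "TYPE('a)" n .
  obtain Q' where Q': "Q' \<in> carrier_mat k k" and inv: "Q * Q' = 1\<^sub>m k"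
    using inverse_mat_ex[OF Q dQ] .
  have "(A * Q) *\<^sub>v v = A *\<^sub>v (Q *\<^sub>v v)" if "v \<in> carrier_vec k" for v
    using A Q that by (rule assoc_mult_mat_vec)
  moreover have "A *\<^sub>v v = (A * Q) *\<^sub>v (Q' *\<^sub>v v)" if v: "v \<in> carrier_vec k" for v
    using A Q Q' v inv by (simp add: assoc_mult_mat_vec[symmetric, of _ _ k _ k] assoc_mult_mat[of _ n k _ k _ k])
  ultimately have "col_space (A * Q) = col_space A"
    using A Q Q' unfolding col_space_eq[OF A] col_space_eq[OF mult_carrier_mat[OF A Q]]
    by (auto intro: mult_mat_vec_carrier)
  then show ?thesis by (simp add: rank_def col_space_def)
qed

text \<open>The columns of the product are the first \<open>r\<close> columns of \<open>P\<close>,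
  which are independent, and possibly zero. An independent set never contains zero, so these
  \<open>r\<close> columns form a maximal independent set of columns.\<close>

lemma rank_mult_diag_one:
  fixes P :: "'a::field mat"
  assumes P: "P \<in> carrier_mat n n" and dP: "det P \<noteq> 0" and r: "r \<le> n"
  shows "vec_space.rank n (P * diag_one n r) = r"
proof -
  interpret vec_space "TYPE('a)" n .
  have rank_P: "rank P = n" using low_rank_det_zero[OF P dP] .
  \<comment> \<open>Distinctness lets the list of columns be treated as a set; without it
    \<open>card S\<close> could fall below \<open>r\<close>.\<close>
  then have dist: "distinct (cols P)" using non_distinct_low_rank[OF P] by auto
  have indpt: "lin_indpt (set (cols P))" using full_rank_lin_indpt[OF P rank_P dist] .
  define S where "S = set (take r (cols P))"
  have col_j: "col (P * diag_one n r) j = (if j < r then col P j else 0\<^sub>v n)" if "j < n" for j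
  proof -
    have "col (P * diag_one n r) j = P *\<^sub>v col (diag_one n r) j"
      using P that by (simp add: diag_one_def col_mult2[of _ n n _ n])
    also have "col (diag_one n r) j = (if j < r then unit_vec n j else 0\<^sub>v n :: 'a vec)"
      using that by (auto simp: diag_one_def unit_vec_def intro!: eq_vecI)
    finally show ?thesis using P that by (auto intro!: eq_vecI)
  qed
  have S: "S = col P ` {..<r}"
  proof -
    have "S = (!) (cols P) ` {0..<r}"
      unfolding S_def by (rule nth_image[symmetric]) (use r P in simp)
    also have "\<dots> = col P ` {..<r}"
      unfolding atLeast0LessThan by (rule image_cong) (use r P in auto)
    finally show ?thesis .
  qed
  have sub: "S \<subseteq> set (cols (P * diag_one n r))" and sup: "set (cols (P * diag_one n r)) \<subseteq> insert (0\<^sub>v n) S"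
    unfolding S 
  proof -
    have cols: "set (cols (P * diag_one n r)) = col (P * diag_one n r) ` {..<n}"
      by (simp add: cols_def diag_one_def atLeast0LessThan)
    show "col P ` {..<r} \<subseteq> set (cols (P * diag_one n r))"
      unfolding cols using col_j r by (force simp: image_iff)
    show "set (cols (P * diag_one n r)) \<subseteq> insert (0\<^sub>v n) (col P ` {..<r})"
      unfolding cols using col_j by auto
  qed
  have indS: "lin_indpt S"
    using indpt unfolding S_def by (rule subset_li_is_li[OF _ set_take_subset])
  have "maximal S (\<lambda>T. T \<subseteq> set (cols (P * diag_one n r)) \<and> lin_indpt T)"
    unfolding maximal_def
  proof (intro conjI allI impI)
    fix T assume T: "S \<subseteq> T \<and> T \<subseteq> set (cols (P * diag_one n r)) \<and> lin_indpt T"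
    then have "T \<subseteq> carrier_vec n" using cols_dim[of "P * diag_one n r"] P by auto
    moreover have "(UNIV :: 'a set) \<noteq> {0}" by (metis UNIV_I singletonD one_neq_zero)
    ultimately have "0\<^sub>v n \<notin> T" using T zero_nin_lin_indpt[of T] by simp
    then show "T = S" using T sup by auto
  qed (use sub indS in auto)
  then have "rank (P * diag_one n r) = card S"
    using P by (intro rank_card_indpt) auto
  also have "card S = r"
    unfolding S_def using dist r P by (subst distinct_card) (auto intro: distinct_take)
  finally show ?thesis .
qed

lemma rank_factorization_rank:
  assumes "rank_factorization n r U" "r \<le> n"
  shows "vec_space.rank n U = r"
proof -
  obtain P Q where PQ: "P \<in> carrier_mat n n" "Q \<in> carrier_mat n n" "det P \<noteq> 0" "det Q \<noteq> 0"
    and U: "U = P * diag_one n r * Q"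
    using assms(1) unfolding rank_factorization_def by blast
  show ?thesis
    unfolding U using rank_mult_invertible_right[of "P * diag_one n r" n n Q] rank_mult_diag_one[of P n r] PQ assms(2)
    by auto
qed

section \<open>Character sums\<close>

locale additive_char =
  fixes \<psi> :: "'a::{field, finite} \<Rightarrow> complex"
  assumes char: "additive_character \<psi>" and nontrivial: "nontrivial_character \<psi>"
begin

lemma char_add: "\<psi> (x + y) = \<psi> x * \<psi> y"
  using char unfolding additive_character_def by blast

lemma char_0 [simp]: "\<psi> 0 = 1"
  using char_add[of 0 0] char unfolding additive_character_def by auto

text \<open>Translating by some \<open>v\<close> with \<open>\<psi> v \<noteq> 1\<close> multiplies
  the sum by \<open>\<psi> v\<close> and also leaves it unchanged.\<close>

lemma char_sum_eq_0: "(\<Sum>x\<in>UNIV. \<psi> x) = 0"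
proof -
  obtain v where v: "\<psi> v \<noteq> 1" using nontrivial unfolding nontrivial_character_def by blast
  have "(\<Sum>x\<in>UNIV. \<psi> x) = (\<Sum>x\<in>UNIV. \<psi> (v + x))"
    by (rule sum.reindex_bij_witness[of _ "\<lambda>x. v + x" "\<lambda>x. x - v"]) auto
  also have "\<dots> = \<psi> v * (\<Sum>x\<in>UNIV. \<psi> x)" by (simp add: char_add sum_distrib_left)
  finally show ?thesis using v by simp
qed

lemma char_sum_nonzero: "(\<Sum>x\<in>UNIV - {0}. \<psi> x) = -1"
  using char_sum_eq_0 by (subst sum_diff) auto

text \<open>Orthogonality for the characters
  \<open>C \<mapsto> \<psi> (mat_inner nr nc X C)\<close>: if \<open>X\<close> is nonzero,
  nondegeneracy supplies a translation \<open>V\<close> that multiplies the sum by a factor other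
  than 1.\<close>

lemma char_sum_carrier_mat:
  assumes X: "X \<in> carrier_mat nr nc"
  shows "(\<Sum>C\<in>carrier_mat nr nc. \<psi> (mat_inner nr nc X C)) =
    (if X = 0\<^sub>m nr nc then of_nat CARD('a) ^ (nr * nc) else 0)"
proof (cases "X = 0\<^sub>m nr nc")
  case True
  then show ?thesis by (simp add: card_carrier_mat)
next
  case False
  obtain v where v: "\<psi> v \<noteq> 1" using nontrivial unfolding nontrivial_character_def by blast
  obtain V where V: "V \<in> carrier_mat nr nc" "mat_inner nr nc X V = v"
    using mat_inner_nondegenerate[OF X False] .
  let ?S = "\<Sum>C\<in>carrier_mat nr nc. \<psi> (mat_inner nr nc X C)"
  have "?S = (\<Sum>C\<in>carrier_mat nr nc. \<psi> (mat_inner nr nc X (V + C)))"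
  proof (rule sum.reindex_bij_witness[of _ "\<lambda>C. V + C" "\<lambda>C. - V + C"])
    fix C :: "'a mat" assume C: "C \<in> carrier_mat nr nc"
    show VC: "V + (- V + C) = C" using C V(1) by (intro eq_matI) auto
    show "- V + (V + C) = C" using C V(1) by (intro eq_matI) auto
    show "- V + C \<in> carrier_mat nr nc" "V + C \<in> carrier_mat nr nc" using C V(1) by auto
    show "\<psi> (mat_inner nr nc X (V + (- V + C))) = \<psi> (mat_inner nr nc X C)" by (simp only: VC)
  qed
  also have "\<dots> = \<psi> v * ?S"
    unfolding sum_distrib_left
    by (intro sum.cong refl) (simp add: mat_inner_add_right[OF V(1)] V(2) char_add)
  finally show ?thesis using v False by simp
qed

section \<open>Sums over matrices of fixed determinant\<close>

text \<open>The sum over the special linear group is the case \<open>d = 1\<close>. General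
  \<open>d\<close> is needed because passing to the normal form and peeling off a row both change
  the determinant.\<close>

definition det_sum :: "nat \<Rightarrow> 'a mat \<Rightarrow> 'a \<Rightarrow> complex" where
  "det_sum n U d = (\<Sum>X\<in>det_mats n d. \<psi> (mat_inner n n U X))"

text \<open>By adjointness \<open>P\<close> acts on \<open>X\<close> through its transpose, which
  rescales the determinant of \<open>X\<close> by \<open>det P\<close>.\<close>

lemma det_sum_mult_left:
  assumes P: "P \<in> carrier_mat n n" "det P \<noteq> 0" and A: "A \<in> carrier_mat n n"
  shows "det_sum n (P * A) d = det_sum n A (det P * d)"
proof -
  have "det_sum n (P * A) d = (\<Sum>X\<in>det_mats n d. \<psi> (mat_inner n n A (transpose_mat P * X)))"
    unfolding det_sum_def
    by (intro sum.cong refl) (simp add: mat_inner_mult_left[OF P(1) A] det_mats_def)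
  also have "\<dots> = det_sum n A (det P * d)"
    unfolding det_sum_def
    using bij_betw_det_mats_mult_left[of "transpose_mat P" n d] P
    by (intro sum.reindex_bij_betw) (simp add: det_transpose)
  finally show ?thesis .
qed

lemma det_sum_mult_right:
  assumes P: "P \<in> carrier_mat n n" "det P \<noteq> 0" and A: "A \<in> carrier_mat n n"
  shows "det_sum n (A * P) d = det_sum n A (d * det P)"
proof -
  have "det_sum n (A * P) d = (\<Sum>X\<in>det_mats n d. \<psi> (mat_inner n n A (X * transpose_mat P)))"
    unfolding det_sum_def
    by (intro sum.cong refl) (simp add: mat_inner_mult_right[OF A P(1)] det_mats_def)
  also have "\<dots> = det_sum n A (d * det P)"
    unfolding det_sum_def
    using bij_betw_det_mats_mult_right[of "transpose_mat P" n d] P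
    by (intro sum.reindex_bij_betw[of "\<lambda>X. X * transpose_mat P"]) (simp add: det_transpose)
  finally show ?thesis .
qed

lemma det_sum_rank_factorization:
  assumes P: "P \<in> carrier_mat n n" "det P \<noteq> 0" and Q: "Q \<in> carrier_mat n n" "det Q \<noteq> 0"
  shows "det_sum n (P * diag_one n r * Q) d = det_sum n (diag_one n r) (det P * det Q * d)"
  using P Q by (simp add: det_sum_mult_right det_sum_mult_left[OF P diag_one_carrier] ac_simps)

section \<open>Peeling off the first row and column\<close>

abbreviation block1 :: "'a \<Rightarrow> 'a mat \<Rightarrow> 'a mat \<Rightarrow> 'a mat \<Rightarrow> 'a mat" where
  "block1 x y z W \<equiv> four_block_mat (mat 1 1 (\<lambda>_. x)) y z W"

lemma block1_cases:
  fixes X :: "'a mat"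
  assumes "X \<in> carrier_mat (1 + m) (1 + m)"
  obtains x y z W where "y \<in> carrier_mat 1 m" "z \<in> carrier_mat m 1" "W \<in> carrier_mat m m"
    "X = block1 x y z W"
proof
  show "X = block1 (X $$ (0, 0)) (mat 1 m (\<lambda>(_, j). X $$ (0, Suc j)))
      (mat m 1 (\<lambda>(i, _). X $$ (Suc i, 0))) (mat m m (\<lambda>(i, j). X $$ (Suc i, Suc j)))"
    using assms by (intro eq_matI) auto
qed simp_all

lemma block1_inject:
  assumes "y \<in> carrier_mat 1 m" "z \<in> carrier_mat m 1" "W \<in> carrier_mat m m"
    "y' \<in> carrier_mat 1 m" "z' \<in> carrier_mat m 1" "W' \<in> carrier_mat m m"
  shows "block1 x y z W = block1 x' y' z' W' \<longleftrightarrow> x = x' \<and> y = y' \<and> z = z' \<and> W = W'"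
proof
  assume eq: "block1 x y z W = block1 x' y' z' W'"
  have ent: "block1 x y z W $$ (i, j) = block1 x' y' z' W' $$ (i, j)" for i j
    using eq by simp
  have "x = x'" using ent[of 0 0] assms by simp
  moreover have "y = y'"
  proof (intro eq_matI)
    fix i j assume "i < dim_row y'" "j < dim_col y'"
    then show "y $$ (i, j) = y' $$ (i, j)" using ent[of 0 "Suc j"] assms by simp
  qed (use assms in auto)
  moreover have "z = z'"
  proof (intro eq_matI)
    fix i j assume "i < dim_row z'" "j < dim_col z'"
    then show "z $$ (i, j) = z' $$ (i, j)" using ent[of "Suc i" 0] assms by simp
  qed (use assms in auto)
  moreover have "W = W'"
  proof (intro eq_matI)
    fix i j assume "i < dim_row W'" "j < dim_col W'"
    then show "W $$ (i, j) = W' $$ (i, j)" using ent[of "Suc i" "Suc j"] assms by simp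
  qed (use assms in auto)
  ultimately show "x = x' \<and> y = y' \<and> z = z' \<and> W = W'" by blast
qed simp

lemma det_block1_lower:
  assumes "z \<in> carrier_mat m 1" "W \<in> carrier_mat m m"
  shows "det (block1 x (0\<^sub>m 1 m) z W) = x * det W"
  using assms by (subst det_four_block_mat_upper_right_zero[of _ 1 _ m]) (simp_all add: det_single)

text \<open>Changing the first row of the fixed matrix to \<open>(1, c)\<close> is a shear and does
  not affect the sum. Averaging over \<open>c\<close> then keeps only the block lower triangular
  \<open>X\<close>, given by a corner \<open>x\<close>, a free column \<open>z\<close> and a block
  of determinant \<open>d / x\<close>.\<close>

lemma det_sum_peel:
  assumes D: "D \<in> carrier_mat m m" and d: "d \<noteq> 0"
  shows "det_sum (1 + m) (block1 1 (0\<^sub>m 1 m) (0\<^sub>m m 1) D) d =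
    of_nat CARD('a) ^ m * (\<Sum>x\<in>UNIV - {0}. \<psi> x * det_sum m D (d / x))"
proof -
  let ?q = "of_nat CARD('a) :: complex"
  let ?n = "1 + m"
  define B where "B = (\<lambda>c. block1 1 c (0\<^sub>m m 1) D)"
  define Y where "Y = (\<lambda>X :: 'a mat. mat 1 m (\<lambda>(_, j). X $$ (0, Suc j)))"
  have shear: "det_sum ?n (B c) d = det_sum ?n (B (0\<^sub>m 1 m)) d" if c: "c \<in> carrier_mat 1 m" for c
  proof -
    \<comment> \<open>Right multiplication by this unipotent matrix turns
      \<open>B (0\<^sub>m 1 m)\<close> into \<open>B c\<close>; its determinant 1 keeps
      \<open>d\<close> fixed.\<close>
    let ?L = "four_block_mat (1\<^sub>m 1) c (0\<^sub>m m 1) (1\<^sub>m m)"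
    have L: "?L \<in> carrier_mat ?n ?n" using c by (simp del: One_nat_def)
    have det: "det ?L = 1"
      using c by (subst det_four_block_mat_lower_left_zero[of _ 1 _ m]) simp_all
    have "mat 1 1 (\<lambda>_. 1) = (1\<^sub>m 1 :: 'a mat)" by (intro eq_matI) auto
    then have "B (0\<^sub>m 1 m) * ?L = B c"
      unfolding B_def using c D
      by (simp add: mult_four_block_mat[of _ 1 1 _ m _ m _ _ 1 _ m] right_add_zero_mat[of _ 1 m] mult_carrier_mat[of _ 1 1 _ m] del: One_nat_def)
    then show ?thesis
      using det_sum_mult_right[OF L, of "B (0\<^sub>m 1 m)" d] det D unfolding B_def by (simp del: One_nat_def)
  qed
  have inner: "mat_inner ?n ?n (B c) X = mat_inner ?n ?n (B (0\<^sub>m 1 m)) X + mat_inner 1 m (Y X) c"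
    if X: "X \<in> carrier_mat ?n ?n" and c: "c \<in> carrier_mat 1 m" for X c
  proof -
    obtain x y z W where yzW: "y \<in> carrier_mat 1 m" "z \<in> carrier_mat m 1" "W \<in> carrier_mat m m"
      and X: "X = block1 x y z W" using block1_cases[OF X] .
    have "Y X = y" unfolding Y_def X using yzW by (intro eq_matI) auto
    then show ?thesis unfolding B_def X using yzW c D
      by (simp add: mat_inner_four_block[of _ 1 1 _ m _ m] mat_inner_commute[of 1 m y c] del: One_nat_def)
  qed
  \<comment> \<open>\<open>I\<close> parametrizes the matrices that survive the averaging.\<close>
  define I where "I = (SIGMA x:UNIV - {0 :: 'a}. (carrier_mat m 1 :: 'a mat set) \<times> det_mats m (d / x))"
  define h where "h = (\<lambda>(x, z, W). block1 x (0\<^sub>m 1 m) z W)"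
  have Yblock: "Y (block1 x y z W) = y"
    if "y \<in> carrier_mat 1 m" "z \<in> carrier_mat m 1" "W \<in> carrier_mat m m" for x y z W
    unfolding Y_def using that by (intro eq_matI) auto
  have bij: "bij_betw h I {X \<in> det_mats ?n d. Y X = 0\<^sub>m 1 m}"
    unfolding bij_betw_def
  proof (intro conjI equalityI subsetI)
    show "inj_on h I"
      unfolding inj_on_def h_def I_def det_mats_def by (auto simp: block1_inject[of _ m] simp del: One_nat_def)
  next
    fix X assume "X \<in> h ` I"
    then show "X \<in> {X \<in> det_mats ?n d. Y X = 0\<^sub>m 1 m}"
      unfolding h_def I_def det_mats_def by (auto simp: Yblock det_block1_lower[of _ m] simp del: One_nat_def)
  next
    fix X assume X: "X \<in> {X \<in> det_mats ?n d. Y X = 0\<^sub>m 1 m}"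
    then have "X \<in> carrier_mat ?n ?n" by (simp add: det_mats_def)
    then obtain x y z W where yzW: "y \<in> carrier_mat 1 m" "z \<in> carrier_mat m 1" "W \<in> carrier_mat m m"
      and Xb: "X = block1 x y z W" by (rule block1_cases)
    have y: "y = 0\<^sub>m 1 m" using X Yblock[OF yzW] unfolding Xb by simp
    have "x * det W = d" using X det_block1_lower[OF yzW(2,3)] unfolding Xb y det_mats_def by simp
    \<comment> \<open>Here \<open>d \<noteq> 0\<close> forces \<open>x \<noteq> 0\<close>, so the
      determinant of \<open>W\<close> is \<open>d / x\<close>.\<close>
    then have "(x, z, W) \<in> I" using d yzW unfolding I_def det_mats_def by (auto simp: field_simps)
    then show "X \<in> h ` I" unfolding Xb y h_def by force
  qed
  have "?q ^ m * det_sum ?n (B (0\<^sub>m 1 m)) d = (\<Sum>c\<in>(carrier_mat 1 m :: 'a mat set). det_sum ?n (B (0\<^sub>m 1 m)) d)"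
    by (simp add: card_carrier_mat)
  also have "\<dots> = (\<Sum>c\<in>carrier_mat 1 m. det_sum ?n (B c) d)"
    by (intro sum.cong refl shear[symmetric])
  also have "\<dots> = (\<Sum>X\<in>det_mats ?n d. \<Sum>c\<in>carrier_mat 1 m. \<psi> (mat_inner ?n ?n (B c) X))"
    unfolding det_sum_def by (rule sum.swap)
  also have "\<dots> = (\<Sum>X\<in>det_mats ?n d. \<psi> (mat_inner ?n ?n (B (0\<^sub>m 1 m)) X) *
      (\<Sum>c\<in>carrier_mat 1 m. \<psi> (mat_inner 1 m (Y X) c)))"
    unfolding sum_distrib_left
  proof (intro sum.cong refl)
    fix X c :: "'a mat" assume "X \<in> det_mats ?n d" and c: "c \<in> carrier_mat 1 m"
    then have X: "X \<in> carrier_mat ?n ?n" by (simp add: det_mats_def)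
    show "\<psi> (mat_inner ?n ?n (B c) X) = \<psi> (mat_inner ?n ?n (B (0\<^sub>m 1 m)) X) * \<psi> (mat_inner 1 m (Y X) c)"
      by (simp only: inner[OF X c] char_add)
  qed
  also have "\<dots> = (\<Sum>X\<in>det_mats ?n d. if Y X = 0\<^sub>m 1 m then \<psi> (mat_inner ?n ?n (B (0\<^sub>m 1 m)) X) * ?q ^ m else 0)"
  proof (intro sum.cong refl, goal_cases)
    case (1 X)
    have "Y X \<in> carrier_mat 1 m" by (simp add: Y_def)
    from char_sum_carrier_mat[OF this] show ?case by (simp del: One_nat_def)
  qed
  also have "\<dots> = (\<Sum>X\<in>{X \<in> det_mats ?n d. Y X = 0\<^sub>m 1 m}. \<psi> (mat_inner ?n ?n (B (0\<^sub>m 1 m)) X) * ?q ^ m)"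
    by (rule sum.inter_filter[symmetric, OF finite_det_mats])
  also have "\<dots> = ?q ^ m * (\<Sum>X\<in>{X \<in> det_mats ?n d. Y X = 0\<^sub>m 1 m}. \<psi> (mat_inner ?n ?n (B (0\<^sub>m 1 m)) X))"
    by (simp add: sum_distrib_left mult.commute)
  \<comment> \<open>The power of the field size produced by orthogonality cancels the number of rows
    \<open>c\<close>; the power in the conclusion arises only later, from \<open>z\<close>.\<close>
  finally have "det_sum ?n (B (0\<^sub>m 1 m)) d =
      (\<Sum>X\<in>{X \<in> det_mats ?n d. Y X = 0\<^sub>m 1 m}. \<psi> (mat_inner ?n ?n (B (0\<^sub>m 1 m)) X))"
    by simp
  also have "\<dots> = (\<Sum>p\<in>I. \<psi> (mat_inner ?n ?n (B (0\<^sub>m 1 m)) (h p)))"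
    by (rule sum.reindex_bij_betw[OF bij, symmetric])
  also have "\<dots> = (\<Sum>(x, z, W)\<in>I. \<psi> x * \<psi> (mat_inner m m D W))"
  proof (intro sum.cong refl, clarify)
    fix x z W assume "(x, z, W) \<in> I"
    then have zW: "z \<in> carrier_mat m 1" "W \<in> carrier_mat m m" by (auto simp: I_def det_mats_def)
    show "\<psi> (mat_inner ?n ?n (B (0\<^sub>m 1 m)) (h (x, z, W))) = \<psi> x * \<psi> (mat_inner m m D W)"
      unfolding B_def h_def using zW D
      by (simp add: mat_inner_four_block[of _ 1 1 _ m _ m] char_add[symmetric] del: One_nat_def)
        (simp add: mat_inner_def)
  qed
  also have "\<dots> = (\<Sum>x\<in>UNIV - {0}. \<Sum>(z, W)\<in>(carrier_mat m 1 :: 'a mat set) \<times> det_mats m (d / x). \<psi> x * \<psi> (mat_inner m m D W))"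
    unfolding I_def by (subst sum.Sigma) (auto simp: finite_carrier_mat finite_det_mats)
  \<comment> \<open>The column \<open>z\<close> is unconstrained and absent from the summand, so it
    contributes only the number of its values.\<close>
  also have "\<dots> = (\<Sum>x\<in>UNIV - {0}. ?q ^ m * (\<psi> x * det_sum m D (d / x)))"
    by (intro sum.cong refl)
      (simp add: sum.cartesian_product[symmetric] card_carrier_mat det_sum_def sum_distrib_left del: One_nat_def)
  finally show ?thesis by (simp add: B_def sum_distrib_left)
qed

lemma det_sum_diag_one_Suc:
  assumes "d \<noteq> 0"
  shows "det_sum (Suc m) (diag_one (Suc m) (Suc r)) d =
    of_nat CARD('a) ^ m * (\<Sum>x\<in>UNIV - {0}. \<psi> x * det_sum m (diag_one m r) (d / x))"
proof -
  have "(1\<^sub>m 1 :: 'a mat) = mat 1 1 (\<lambda>_. 1)" by (intro eq_matI) auto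
  then show ?thesis
    using det_sum_peel[OF diag_one_carrier assms, of m r] diag_one_Suc[of m r, where 'a = 'a] by simp
qed

section \<open>Kloosterman recursion and full rank\<close>

text \<open>The last variable is split off as \<open>x\<close>; since \<open>d \<noteq> 0\<close> it
  is nonzero, and the other variables multiply to \<open>d / x\<close>.\<close>

lemma kloosterman_sum_Suc:
  fixes d :: 'a
  assumes d: "d \<noteq> 0"
  shows "kloosterman_sum (Suc n) \<psi> d = (\<Sum>x\<in>UNIV - {0}. \<psi> x * kloosterman_sum n \<psi> (d / x))"
proof -
  let ?F = "\<lambda>n y. {x \<in> {1..n} \<rightarrow>\<^sub>E (UNIV :: 'a set). (\<Prod>i = 1..n. x i) = y}"
  let ?I = "SIGMA x:UNIV - {0}. ?F n (d / x)"
  have restr: "(\<Prod>i = 1..n. (f(Suc n := x)) i) = (\<Prod>i = 1..n. f i)"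
    "(\<Sum>i = 1..n. (f(Suc n := x)) i) = (\<Sum>i = 1..n. f i)" for f :: "nat \<Rightarrow> 'a" and x
    by (intro prod.cong sum.cong; simp)+
  have "(\<Sum>x\<in>UNIV - {0}. \<psi> x * kloosterman_sum n \<psi> (d / x)) =
      (\<Sum>(x, f)\<in>?I. \<psi> x * \<psi> (\<Sum>i = 1..n. f i))"
    unfolding kloosterman_sum_def sum_distrib_left
    by (subst sum.Sigma) (use finite_kloosterman_index in \<open>auto simp del: One_nat_def\<close>)
  also have "\<dots> = kloosterman_sum (Suc n) \<psi> d"
    unfolding kloosterman_sum_def
  proof (rule sum.reindex_bij_witness[where j = "\<lambda>(x, f). f(Suc n := x)"
        and i = "\<lambda>f. (f (Suc n), f(Suc n := undefined))"])
    fix p assume "p \<in> ?I"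
    then obtain x f where p: "p = (x, f)" and x: "x \<noteq> 0" and f: "f \<in> ?F n (d / x)" by auto
    \<comment> \<open>Extensional tuples are \<open>undefined\<close> off their index set, so
      resetting position \<open>Suc n\<close> to \<open>undefined\<close> inverts the
      update.\<close>
    have "f (Suc n) = undefined" using f by (auto simp: PiE_def extensional_def)
    then show "(\<lambda>f. (f (Suc n), f(Suc n := undefined))) ((\<lambda>(x, f). f(Suc n := x)) p) = p"
      unfolding p by auto
    show "(\<lambda>(x, f). f(Suc n := x)) p \<in> ?F (Suc n) d"
      unfolding p using f x restr by (auto simp: PiE_def extensional_def simp del: fun_upd_apply) auto
    show "\<psi> (\<Sum>i = 1..Suc n. (\<lambda>(x, f). f(Suc n := x)) p i) = (\<lambda>(x, f). \<psi> x * \<psi> (\<Sum>i = 1..n. f i)) p"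
      unfolding p using restr by (simp add: char_add mult.commute del: fun_upd_apply) simp
  next
    fix f assume f: "f \<in> ?F (Suc n) d"
    show "(\<lambda>(x, f). f(Suc n := x)) (f (Suc n), f(Suc n := undefined)) = f" by simp
    have "(\<Prod>i = 1..n. f i) * f (Suc n) = d" using f by simp
    then show "(f (Suc n), f(Suc n := undefined)) \<in> ?I"
      using f d restr by (auto simp: PiE_def extensional_def field_simps simp del: fun_upd_apply) auto
  qed
  finally show ?thesis by simp
qed

lemma choose_2_Suc: "Suc n choose 2 = n + (n choose 2)"
  by (simp add: numeral_2_eq_2)

text \<open>Peeling the identity matrix gives the Kloosterman recursion with an extra factor
  \<open>of_nat CARD('a) ^ n\<close>; these exponents add up to \<open>n choose 2\<close>.\<close>

lemma det_sum_one_mat: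
  assumes "d \<noteq> 0"
  shows "det_sum n (1\<^sub>m n) d = of_nat CARD('a) ^ (n choose 2) * kloosterman_sum n \<psi> d"
  using assms
proof (induction n arbitrary: d)
  case 0
  \<comment> \<open>The empty matrix has determinant 1 and the empty product is 1, so at size 0 both
    sides are 1 for \<open>d = 1\<close> and 0 otherwise.\<close>
  have "det_mats 0 d = (if d = 1 then {1\<^sub>m 0} else {})"
    by (auto simp: det_mats_def intro!: eq_matI)
  then show ?case
    by (simp add: det_sum_def kloosterman_sum_def mat_inner_def binomial_eq_0)
next
  case (Suc n)
  then show ?case
    using det_sum_diag_one_Suc[of d n n]
    by (simp add: kloosterman_sum_Suc sum_distrib_left choose_2_Suc power_add mult_ac)
qed

section \<open>Counting matrices of given determinant\<close>

lemma det_sum_zero: "det_sum n (0\<^sub>m n n) d = of_nat (card (det_mats n d))"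
  by (simp add: det_sum_def)

text \<open>One peeling step leaves the zero matrix, whose sum is a count. As the count
  \<open>N\<close> is the same for all nonzero determinants, it factors out of the sum of
  \<open>\<psi> x\<close> over \<open>x \<noteq> 0\<close>, which is -1.\<close>

lemma det_sum_rank_one:
  assumes U: "U \<in> carrier_mat (Suc m) (Suc m)" and nz: "U \<noteq> 0\<^sub>m (Suc m) (Suc m)"
    and prod: "\<And>i j. i < Suc m \<Longrightarrow> j < Suc m \<Longrightarrow> U $$ (i, j) = f i * g j"
    and card: "\<And>d. d \<noteq> 0 \<Longrightarrow> of_nat (card (det_mats m d :: 'a mat set)) = N" and d: "d \<noteq> 0"
  shows "det_sum (Suc m) U d = - (of_nat CARD('a) ^ m * N)"
proof -
  obtain r where r: "r \<le> Suc m" and fac: "rank_factorization (Suc m) r U"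
    using rank_factorization_ex[OF U] by blast
  obtain P Q where PQ: "P \<in> carrier_mat (Suc m) (Suc m)" "det P \<noteq> 0" "Q \<in> carrier_mat (Suc m) (Suc m)" "det Q \<noteq> 0"
    and U_eq: "U = P * diag_one (Suc m) r * Q"
    using fac unfolding rank_factorization_def by blast
  have "r \<noteq> 0" using nz PQ unfolding U_eq by auto
  \<comment> \<open>The entries are products \<open>f i * g j\<close>, which bounds the rank by
    1.\<close>
  moreover have "r \<le> 1"
    using vec_space.rank_le_1_product_entries[OF U, of f g] prod U rank_factorization_rank[OF fac r] by auto
  ultimately have "r = Suc 0" by simp
  then have "det_sum (Suc m) U d = det_sum (Suc m) (diag_one (Suc m) (Suc 0)) (det P * det Q * d)"
    unfolding U_eq using det_sum_rank_factorization[OF PQ] by simp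
  also have "\<dots> = of_nat CARD('a) ^ m * (\<Sum>x\<in>UNIV - {0}. \<psi> x * N)"
    using PQ d by (subst det_sum_diag_one_Suc) (auto simp: det_sum_zero card)
  also have "\<dots> = - (of_nat CARD('a) ^ m * N)"
    by (simp only: sum_distrib_right[symmetric] char_sum_nonzero) simp
  finally show ?thesis .
qed

text \<open>The sums for all \<open>U r\<close>, supported on the first row, add up to 0: an
  \<open>X\<close> of nonzero determinant has a nonzero first row, so orthogonality in
  \<open>r\<close> applies. The term \<open>r = 0\<close> is the wanted count, and every other
  \<open>r\<close> gives the same rank one value.\<close>

lemma card_det_mats_Suc:
  fixes N :: complex
  assumes card: "\<And>d. d \<noteq> 0 \<Longrightarrow> of_nat (card (det_mats m d :: 'a mat set)) = N" and d: "d \<noteq> 0"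
  shows "of_nat (card (det_mats (Suc m) d :: 'a mat set)) =
    (of_nat CARD('a) ^ Suc m - 1) * (of_nat CARD('a) ^ m * N)"
proof -
  let ?n = "Suc m" and ?q = "of_nat CARD('a) :: complex"
  define U where "U = (\<lambda>r :: 'a mat. mat ?n ?n (\<lambda>(i, j). if i = 0 then r $$ (0, j) else 0))"
  define R where "R = (\<lambda>X :: 'a mat. mat 1 ?n (\<lambda>(_, j). X $$ (0, j)))"
  have U0: "U (0\<^sub>m 1 ?n) = 0\<^sub>m ?n ?n" by (auto simp: U_def intro!: eq_matI)
  have inner: "mat_inner ?n ?n (U r) X = mat_inner 1 ?n (R X) r" for r X
  proof -
    have "mat_inner ?n ?n (U r) X = (\<Sum>i<?n. if i = 0 then \<Sum>j<?n. r $$ (0, j) * X $$ (0, j) else 0)"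
      unfolding mat_inner_def U_def by (intro sum.cong refl) auto
    also have "\<dots> = mat_inner 1 ?n (R X) r"
      by (simp add: mat_inner_def R_def mult.commute sum.lessThan_Suc[where n = 0] del: sum.lessThan_Suc)
    finally show ?thesis .
  qed
  have R: "R X \<noteq> 0\<^sub>m 1 ?n" if X: "X \<in> det_mats ?n d" for X
  proof
    assume eq: "R X = 0\<^sub>m 1 ?n"
    have entry: "X $$ (0, j) = 0" if "j < ?n" for j
      using that arg_cong[OF eq, of "\<lambda>A. A $$ (0, j)"] by (simp add: R_def)
    have "det X = (\<Sum>j<?n. X $$ (0, j) * cofactor X 0 j)"
      using X by (intro laplace_expansion_row) (auto simp: det_mats_def)
    also have "\<dots> = 0" by (intro sum.neutral ballI) (simp add: entry)
    finally have "det X = 0" .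
    then show False using X d by (simp add: det_mats_def)
  qed
  have "(\<Sum>r\<in>carrier_mat 1 ?n. det_sum ?n (U r) d) =
      (\<Sum>X\<in>det_mats ?n d. \<Sum>r\<in>carrier_mat 1 ?n. \<psi> (mat_inner 1 ?n (R X) r))"
    unfolding det_sum_def inner by (rule sum.swap)
  also have "\<dots> = 0"
  proof (rule sum.neutral, rule ballI)
    fix X assume "X \<in> det_mats ?n d"
    then show "(\<Sum>r\<in>carrier_mat 1 ?n. \<psi> (mat_inner 1 ?n (R X) r)) = 0"
      using char_sum_carrier_mat[of "R X" 1 ?n] R by (simp add: R_def del: One_nat_def)
  qed
  finally have zero: "(\<Sum>r\<in>carrier_mat 1 ?n. det_sum ?n (U r) d) = 0" .
  have nz: "det_sum ?n (U r) d = - (?q ^ m * N)" if r: "r \<in> carrier_mat 1 ?n - {0\<^sub>m 1 ?n}" for r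
  proof (rule det_sum_rank_one[where f = "\<lambda>i. if i = 0 then 1 else 0" and g = "\<lambda>j. r $$ (0, j)"])
    show "U r \<noteq> 0\<^sub>m ?n ?n"
    proof
      assume eq: "U r = 0\<^sub>m ?n ?n"
      have "r $$ (0, j) = 0" if "j < ?n" for j
        using arg_cong[OF eq, of "\<lambda>A. A $$ (0, j)"] that by (simp add: U_def)
      then have "r = 0\<^sub>m 1 ?n" using r by (intro eq_matI) auto
      then show False using r by simp
    qed
  qed (use card d in \<open>auto simp: U_def\<close>)
  have "(\<Sum>r\<in>carrier_mat 1 ?n. det_sum ?n (U r) d) =
      det_sum ?n (U (0\<^sub>m 1 ?n)) d + (\<Sum>r\<in>carrier_mat 1 ?n - {0\<^sub>m 1 ?n}. det_sum ?n (U r) d)"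
    by (rule sum.remove) (simp_all add: finite_carrier_mat)
  also have "(\<Sum>r\<in>carrier_mat 1 ?n - {0\<^sub>m 1 ?n}. det_sum ?n (U r) d) =
      of_nat (card (carrier_mat 1 ?n - {0\<^sub>m 1 ?n} :: 'a mat set)) * - (?q ^ m * N)"
    using nz by simp
  also have "card (carrier_mat 1 ?n - {0\<^sub>m 1 ?n} :: 'a mat set) = CARD('a) ^ ?n - 1"
    by (simp add: card_Diff_singleton card_carrier_mat)
  also have "of_nat (CARD('a) ^ ?n - 1) = ?q ^ ?n - 1"
    by (subst of_nat_diff) simp_all
  finally show ?thesis using zero by (simp add: U0[unfolded One_nat_def] det_sum_zero algebra_simps)
qed

text \<open>The induction starts at size 1, with a single matrix for each \<open>d\<close>; at size
  0 only \<open>d = 1\<close> occurs. The product starts at 2: the factor for \<open>i = 1\<close>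
  in the order of the general linear group counts the possible determinants.\<close>

lemma card_det_mats:
  assumes "d \<noteq> 0"
  shows "of_nat (card (det_mats (Suc m) d :: 'a mat set)) =
    of_nat CARD('a) ^ (Suc m choose 2) * (\<Prod>i = 2..Suc m. of_nat CARD('a) ^ i - 1 :: complex)"
  using assms
proof (induction m arbitrary: d)
  case 0
  have "det_mats 1 d = {mat 1 1 (\<lambda>_. d)}"
    by (auto simp: det_mats_def det_single intro!: eq_matI)
  then show ?case by (simp add: binomial_eq_0)
next
  case (Suc m)
  have "{2..Suc (Suc m)} = insert (Suc (Suc m)) {2..Suc m}" by auto
  then show ?case
    by (subst card_det_mats_Suc[OF Suc.IH Suc.prems]) (simp_all add: choose_2_Suc[of "Suc m"] power_add mult_ac)
qed

section \<open>Singular normal forms\<close>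

text \<open>Size \<open>r + Suc k\<close> keeps the corank positive, so peeling ends at a zero
  matrix of size \<open>Suc k\<close>, where the count applies. The smaller sum is the same for
  every \<open>d / x\<close>, hence each step gives a factor -1 and a power of the field
  size.\<close>

lemma det_sum_diag_one:
  assumes "d \<noteq> 0"
  shows "det_sum (r + Suc k) (diag_one (r + Suc k) r) d =
    (- 1) ^ r * of_nat CARD('a) ^ ((r + Suc k) choose 2) * (\<Prod>i = 2..Suc k. of_nat CARD('a) ^ i - 1)"
  using assms
proof (induction r arbitrary: d)
  case 0
  then show ?case by (simp add: det_sum_zero card_det_mats)
next
  case (Suc r)
  let ?c = "(- 1) ^ r * of_nat CARD('a) ^ ((r + Suc k) choose 2) * (\<Prod>i = 2..Suc k. of_nat CARD('a) ^ i - 1) :: complex"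
  have "det_sum (Suc r + Suc k) (diag_one (Suc r + Suc k) (Suc r)) d =
      of_nat CARD('a) ^ (r + Suc k) * (\<Sum>x\<in>UNIV - {0}. \<psi> x * det_sum (r + Suc k) (diag_one (r + Suc k) r) (d / x))"
    by (simp only: add_Suc det_sum_diag_one_Suc[OF Suc.prems])
  also have "(\<Sum>x\<in>UNIV - {0}. \<psi> x * det_sum (r + Suc k) (diag_one (r + Suc k) r) (d / x)) =
      (\<Sum>x\<in>UNIV - {0}. \<psi> x * ?c)"
  proof (intro sum.cong refl)
    fix x :: 'a assume "x \<in> UNIV - {0}"
    then have "d / x \<noteq> 0" using Suc.prems by simp
    from Suc.IH[OF this] show "\<psi> x * det_sum (r + Suc k) (diag_one (r + Suc k) r) (d / x) = \<psi> x * ?c"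
      by (simp only:)
  qed
  also have "(\<Sum>x\<in>UNIV - {0}. \<psi> x * ?c) = - ?c"
    by (simp only: sum_distrib_right[symmetric] char_sum_nonzero) simp
  finally show ?case by (simp only: add_Suc choose_2_Suc power_add) simp
qed

end

section \<open>From the normal form to the two cases\<close>

theorem theorem2p4:
  fixes U :: "'a::{field, finite} mat"
    and \<psi> :: "'a \<Rightarrow> complex"
    and n q u :: nat
  assumes "q = CARD('a)"
    and "n \<ge> 1"
    and "additive_character \<psi>"
    and "nontrivial_character \<psi>"
    and "U \<in> carrier_mat n n"
    and "U \<noteq> 0\<^sub>m n n"
    and "u = vec_space.rank n U"
  shows "(u = n \<longrightarrow>
            gauss_sum_SL n U \<psi> = of_nat q ^ (n choose 2) * kloosterman_sum n \<psi> (det U)) \<and>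
         (u < n \<longrightarrow>
            gauss_sum_SL n U \<psi> =
              (- 1) ^ u * of_nat q ^ (n choose 2) * (\<Prod>i = 2..n - u. of_nat q ^ i - 1))"
proof -
  interpret additive_char \<psi> using assms by unfold_locales
  obtain r where r: "r \<le> n" and fac: "rank_factorization n r U"
    using rank_factorization_ex[OF assms(5)] by blast
  then have u: "u = r" using rank_factorization_rank assms(7) by blast
  obtain P Q where PQ: "P \<in> carrier_mat n n" "det P \<noteq> 0" "Q \<in> carrier_mat n n" "det Q \<noteq> 0"
    and U_eq: "U = P * diag_one n u * Q"
    using fac unfolding rank_factorization_def u by blast
  have "gauss_sum_SL n U \<psi> = det_sum n U 1"
    by (simp add: gauss_sum_SL_def det_sum_def SL_mat_def det_mats_def mat_dot_def mat_inner_def)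
  also have "\<dots> = det_sum n (diag_one n u) (det P * det Q)"
    unfolding U_eq using det_sum_rank_factorization[OF PQ] by simp
  finally have sum_eq: "gauss_sum_SL n U \<psi> = det_sum n (diag_one n u) (det P * det Q)" .
  show ?thesis
  proof (intro conjI impI)
    assume "u = n"
    \<comment> \<open>For \<open>u = n\<close> the diagonal factor is the identity, so the
      transformed determinant is that of \<open>U\<close>.\<close>
    moreover from this have "det U = det P * det Q"
      unfolding U_eq using PQ by (simp add: det_mult[of _ n])
    ultimately show "gauss_sum_SL n U \<psi> = of_nat q ^ (n choose 2) * kloosterman_sum n \<psi> (det U)"
      using sum_eq det_sum_one_mat[of "det P * det Q" n] PQ assms(1) by simp
  next
    assume "u < n"
    \<comment> \<open>With this \<open>k\<close> the corank \<open>n - u\<close> is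
      \<open>Suc k\<close>, the upper limit of the product in the singular case.\<close>
    then obtain k where "n = u + Suc k" using less_imp_Suc_add[of u n] by auto
    then show "gauss_sum_SL n U \<psi> =
        (- 1) ^ u * of_nat q ^ (n choose 2) * (\<Prod>i = 2..n - u. of_nat q ^ i - 1)"
      using sum_eq det_sum_diag_one[of "det P * det Q" u k] PQ assms(1) by simp
  qed
qed

end
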